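(* Let $F$ be a field of characteristic zero and let $\delta\in F$ with $\delta\neq 1$. Every identity satisfied by the commutator product $[a,b]=a\cdot b-b\cdot a$ in every $\delta$-Novikov algebra over $F$ is a consequence of the anti-commutativity, Jacobi and metabelian identities. That is, if $f$ is a nonassociative polynomial (in one binary operation, over $F$) that vanishes identically on $(N,[\cdot,\cdot])$ for every $\delta$-Novikov algebra $(N,\cdot)$ over $F$, then $f$ vanishes identically on every metabelian Lie algebra over $F$.
   Context: A (left) $\delta$-Novikov algebra is a (not necessarily associative) algebra satisfying, for all $x,y,z$, $\delta(xy)z-x(yz)=\delta(yx)z-y(xz)$ and $(xy)z=(xz)y$. A metabelian Lie algebra is a Lie algebra satisfying the metabelian identity $[[x,y],[z,t]]=0$. *)

theory Defs
  imports Complex_Main "HOL-Library.Poly_Mapping"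
begin

datatype na_mono = Var nat | Prod na_mono na_mono

text \<open>The elements of the free nonassociative (non-unital) algebra over \<open>'f\<close> on countably many
  generators, as finitely supported coefficient functions. Only the additive group structure of
  \<open>'f na_poly\<close> is used.\<close>

type_synonym 'f na_poly = "na_mono \<Rightarrow>\<^sub>0 'f"

primrec eval_mono :: "('a \<Rightarrow> 'a \<Rightarrow> 'a) \<Rightarrow> (nat \<Rightarrow> 'a) \<Rightarrow> na_mono \<Rightarrow> 'a" where
  "eval_mono mult \<rho> (Var i) = \<rho> i"
| "eval_mono mult \<rho> (Prod s t) = mult (eval_mono mult \<rho> s) (eval_mono mult \<rho> t)"

definition eval_poly ::
  "('f::zero \<Rightarrow> 'a::comm_monoid_add \<Rightarrow> 'a) \<Rightarrow> ('a \<Rightarrow> 'a \<Rightarrow> 'a) \<Rightarrow> (nat \<Rightarrow> 'a) \<Rightarrow> 'f na_poly \<Rightarrow> 'a" where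
  "eval_poly scale mult \<rho> f =
     (\<Sum>m\<in>Poly_Mapping.keys f. scale (Poly_Mapping.lookup f m) (eval_mono mult \<rho> m))"

definition is_identity ::
  "('f::zero \<Rightarrow> 'a::comm_monoid_add \<Rightarrow> 'a) \<Rightarrow> 'a set \<Rightarrow> ('a \<Rightarrow> 'a \<Rightarrow> 'a) \<Rightarrow> 'f na_poly \<Rightarrow> bool" where
  "is_identity scale A mult f \<longleftrightarrow>
     (\<forall>\<rho>. (\<forall>i. \<rho> i \<in> A) \<longrightarrow> eval_poly scale mult \<rho> f = 0)"

definition commutator :: "('a \<Rightarrow> 'a \<Rightarrow> 'a::minus) \<Rightarrow> 'a \<Rightarrow> 'a \<Rightarrow> 'a" where
  "commutator mult a b = mult a b - mult b a"

text \<open>The underlying vector space of an algebra is a linear subspace \<open>A\<close> of an ambient vector space,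
  and the product is constrained only on \<open>A\<close>. So a quantifier over scalar multiplications, carriers
  and products at one ambient type covers algebras of different dimensions.\<close>

locale na_algebra = vector_space scale
  for scale :: "'f::field \<Rightarrow> 'a::ab_group_add \<Rightarrow> 'a" +
  fixes A :: "'a set" and mult :: "'a \<Rightarrow> 'a \<Rightarrow> 'a"
  assumes subspace_A: "subspace A"
    and mult_closed: "\<lbrakk>x \<in> A; y \<in> A\<rbrakk> \<Longrightarrow> mult x y \<in> A"
    and mult_add_left: "\<lbrakk>x \<in> A; y \<in> A; z \<in> A\<rbrakk> \<Longrightarrow> mult (x + y) z = mult x z + mult y z"
    and mult_add_right: "\<lbrakk>x \<in> A; y \<in> A; z \<in> A\<rbrakk> \<Longrightarrow> mult x (y + z) = mult x y + mult x z"
    and mult_scale_left: "\<lbrakk>x \<in> A; y \<in> A\<rbrakk> \<Longrightarrow> mult (scale c x) y = scale c (mult x y)"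
    and mult_scale_right: "\<lbrakk>x \<in> A; y \<in> A\<rbrakk> \<Longrightarrow> mult x (scale c y) = scale c (mult x y)"

locale delta_novikov_algebra = na_algebra scale A mult
  for scale :: "'f::field \<Rightarrow> 'a::ab_group_add \<Rightarrow> 'a" and A mult +
  fixes \<delta> :: 'f
  assumes delta_left_symmetric: "\<lbrakk>x \<in> A; y \<in> A; z \<in> A\<rbrakk> \<Longrightarrow>
      scale \<delta> (mult (mult x y) z) - mult x (mult y z) =
      scale \<delta> (mult (mult y x) z) - mult y (mult x z)"
    and right_commutative: "\<lbrakk>x \<in> A; y \<in> A; z \<in> A\<rbrakk> \<Longrightarrow> mult (mult x y) z = mult (mult x z) y"

text \<open>Over a field of characteristic zero, anti-commutativity is equivalent to \<open>[x, x] = 0\<close>.\<close>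

locale metabelian_lie_algebra = na_algebra scale A bracket
  for scale :: "'f::field_char_0 \<Rightarrow> 'a::ab_group_add \<Rightarrow> 'a" and A bracket +
  assumes anticommutative: "\<lbrakk>x \<in> A; y \<in> A\<rbrakk> \<Longrightarrow> bracket x y = - bracket y x"
    and jacobi: "\<lbrakk>x \<in> A; y \<in> A; z \<in> A\<rbrakk> \<Longrightarrow>
      bracket (bracket x y) z + bracket (bracket y z) x + bracket (bracket z x) y = 0"
    and metabelian: "\<lbrakk>x \<in> A; y \<in> A; z \<in> A; t \<in> A\<rbrakk> \<Longrightarrow>
      bracket (bracket x y) (bracket z t) = 0"

text \<open>A quantifier over types is not available inside a formula, so the statement tests \<open>f\<close> on the
  \<open>\<delta>\<close>-Novikov algebras with carrier in the fixed type \<open>'f na_poly\<close>. This loses nothing: an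
  evaluation of \<open>f\<close> takes place in a countably generated subalgebra, which is isomorphic to an
  algebra with carrier in \<open>'f na_poly\<close>.\<close>

lemma is_identity_delta_novikov_any_type:
  fixes \<delta> :: "'f::field" and f :: "'f na_poly"
    and scaleN :: "'f \<Rightarrow> 'b::ab_group_add \<Rightarrow> 'b"
  assumes ident: "\<And>(scale :: 'f \<Rightarrow> 'f na_poly \<Rightarrow> 'f na_poly) N mult.
      delta_novikov_algebra scale N mult \<delta> \<Longrightarrow> is_identity scale N (commutator mult) f"
    and nov: "delta_novikov_algebra scaleN N multN \<delta>"
  shows "is_identity scaleN N (commutator multN) f"
proof -
  interpret N: delta_novikov_algebra scaleN N multN \<delta> by (fact nov)
  define sc :: "'f \<Rightarrow> 'f na_poly \<Rightarrow> 'f na_poly" where "sc c p = Poly_Mapping.map ((*) c) p" for c p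
  have lookup_sc: "Poly_Mapping.lookup (sc c p) m = c * Poly_Mapping.lookup p m" for c p m
    by (simp add: sc_def Poly_Mapping.map.rep_eq when_def)
  interpret T: vector_space sc
    by standard (auto intro!: poly_mapping_eqI simp: lookup_sc lookup_add algebra_simps)
  interpret P: vector_space_pair sc scaleN ..
  have "eval_poly scaleN (commutator multN) \<rho> f = 0" if \<rho>: "\<And>i. \<rho> i \<in> N" for \<rho>
  proof -
    let ?e = "eval_mono multN \<rho>"
    define h where "h = eval_poly scaleN multN \<rho>"
    have h_sup: "h p = (\<Sum>m\<in>K. scaleN (Poly_Mapping.lookup p m) (?e m))"
      if "finite K" "Poly_Mapping.keys p \<subseteq> K" for p K
      unfolding h_def eval_poly_def using that
      by (intro sum.mono_neutral_left) (auto simp: in_keys_iff)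
    have lin_h: "Vector_Spaces.linear sc scaleN h"
    proof
      fix p q :: "'f na_poly"
      let ?K = "Poly_Mapping.keys p \<union> Poly_Mapping.keys q"
      show "h (p + q) = h p + h q"
        using keys_add[of p q]
        by (subst (1 2 3) h_sup[of ?K])
           (auto simp: lookup_add N.scale_left_distrib sum.distrib)
    next
      fix c and p :: "'f na_poly"
      have "Poly_Mapping.keys (sc c p) \<subseteq> Poly_Mapping.keys p"
        by (auto simp: in_keys_iff lookup_sc)
      then show "h (sc c p) = scaleN c (h p)"
        by (subst (1 2) h_sup[of "Poly_Mapping.keys p"])
           (auto simp: lookup_sc N.scale_sum_right)
    qed
    let ?B = "range h"
    have e_N: "?e m \<in> N" for m
      by (induction m) (auto simp: \<rho> N.mult_closed)
    have B_sub: "N.subspace ?B"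
      using P.linear_subspace_image[OF lin_h T.subspace_UNIV] .
    have B_N: "h p \<in> N" for p
      unfolding h_def eval_poly_def
      by (intro N.subspace_sum N.subspace_scale N.subspace_A e_N)
    have e_B: "?e m \<in> ?B" for m
    proof
      show "?e m = h (Poly_Mapping.single m 1)" by (simp add: h_def eval_poly_def)
    qed simp
    have B_eq: "?B = N.span (range ?e)"
    proof
      show "?B \<subseteq> N.span (range ?e)"
        unfolding h_def eval_poly_def
        by (intro image_subsetI N.span_sum N.span_scale N.span_base rangeI)
      show "N.span (range ?e) \<subseteq> ?B"
        using e_B by (intro N.span_minimal B_sub) auto
    qed
    have zl: "multN 0 y = 0" and zr: "multN y 0 = 0" if "y \<in> N" for y
      using N.mult_scale_left[of y y 0] N.mult_scale_right[of y y 0] that by auto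
    have B_mult: "multN x y \<in> ?B" if x: "x \<in> ?B" and y: "y \<in> ?B" for x y
    proof -
      have 1: "multN (?e m) y \<in> ?B" for m
      proof -
        have "y \<in> N.span (range ?e)" using y B_eq by simp
        then have "multN (?e m) y \<in> ?B \<and> y \<in> N"
        proof (induction rule: N.span_induct_alt)
          case base
          then show ?case using zr e_N N.subspace_0[OF B_sub] N.subspace_0[OF N.subspace_A] by simp
        next
          case (step c u v)
          then obtain n where u: "u = ?e n" by auto
          have "multN (?e m) u \<in> ?B" using e_B[of "Prod m n"] u by simp
          then show ?case using step u e_N
            by (auto simp: N.mult_add_right N.mult_scale_right N.subspace_scale N.subspace_A
                intro!: N.subspace_add[OF B_sub] N.subspace_scale[OF B_sub] N.subspace_add[OF N.subspace_A])
        qed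
        then show ?thesis by simp
      qed
      have yN: "y \<in> N" using y B_N by auto
      have "x \<in> N.span (range ?e)" using x B_eq by simp
      then have "multN x y \<in> ?B \<and> x \<in> N"
      proof (induction rule: N.span_induct_alt)
        case base
        then show ?case using zl yN N.subspace_0[OF B_sub] N.subspace_0[OF N.subspace_A] by simp
      next
        case (step c u v)
        then obtain n where u: "u = ?e n" by auto
        then show ?case using step 1[of n] e_N yN
          by (auto simp: N.mult_add_left N.mult_scale_left N.subspace_scale N.subspace_A
              intro!: N.subspace_add[OF B_sub] N.subspace_scale[OF B_sub] N.subspace_add[OF N.subspace_A])
      qed
      then show ?thesis by simp
    qed
    obtain g where lin_g: "Vector_Spaces.linear scaleN sc g" and hg: "\<And>v. v \<in> ?B \<Longrightarrow> h (g v) = v"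
      using P.linear_exists_right_inverse_on[OF lin_h T.subspace_UNIV] by blast
    interpret g: Vector_Spaces.linear scaleN sc g by (fact lin_g)
    interpret h: Vector_Spaces.linear sc scaleN h by (fact lin_h)
    define M where "M = g ` ?B"
    define mult where "mult x y = g (multN (h x) (h y))" for x y
    have gh: "g (h x) = x" if "x \<in> M" for x
      using that hg by (auto simp: M_def)
    have M_closed: "mult x y \<in> M" for x y
      unfolding mult_def M_def by (intro imageI B_mult) auto
    have h_mult: "h (mult x y) = multN (h x) (h y)" for x y
      unfolding mult_def by (intro hg B_mult) auto
    have M_alg: "delta_novikov_algebra sc M mult \<delta>"
    proof
      show "T.subspace M" unfolding M_def by (intro g.subspace_image B_sub)
      fix x y z
      show "mult x y \<in> M" by (rule M_closed)
      show "mult (x + y) z = mult x z + mult y z" "mult x (y + z) = mult x y + mult x z"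
        by (simp_all add: mult_def h.add g.add N.mult_add_left N.mult_add_right B_N)
      show "mult (sc c x) y = sc c (mult x y)" "mult x (sc c y) = sc c (mult x y)" for c
        by (simp_all add: mult_def h.scale g.scale N.mult_scale_left N.mult_scale_right B_N)
      show "mult (mult x y) z = mult (mult x z) y"
        by (simp add: mult_def[of "mult _ _"] h_mult N.right_commutative B_N)
      show "sc \<delta> (mult (mult x y) z) - mult x (mult y z) =
            sc \<delta> (mult (mult y x) z) - mult y (mult x z)"
        by (simp add: mult_def[of "mult _ _"] mult_def[of _ "mult _ _"] h_mult
            N.delta_left_symmetric[OF B_N B_N B_N] flip: g.scale g.diff)
    qed
    have \<rho>_B: "\<rho> i \<in> ?B" for i using e_B[of "Var i"] by simp
    let ?\<sigma> = "\<lambda>i. g (\<rho> i)"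
    have "eval_poly sc (commutator mult) ?\<sigma> f = 0"
      using ident[OF M_alg] \<rho>_B by (auto simp: is_identity_def M_def)
    moreover have "h (eval_mono (commutator mult) ?\<sigma> m) = eval_mono (commutator multN) \<rho> m" for m
      by (induction m) (simp_all add: hg \<rho>_B commutator_def h.diff h_mult)
    then have "h (eval_poly sc (commutator mult) ?\<sigma> f) = eval_poly scaleN (commutator multN) \<rho> f"
      by (simp add: eval_poly_def h.sum h.scale)
    ultimately show ?thesis by (simp add: h.zero)
  qed
  then show ?thesis by (simp add: is_identity_def)
qed

end

theory Submission
  imports Defs "HOL-Library.Multiset" "HOL-Library.Product_Plus"
begin

text \<open>The two-dimensional nonabelian Lie algebra already generates the variety of metabelian Lie
  algebras, and for every \<open>\<delta>\<close> it is the commutator algebra of a \<open>\<delta>\<close>-Novikov algebra: take a basis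
  \<open>a, b\<close> with \<open>a a = \<delta> a\<close>, \<open>b a = b\<close>, \<open>a b = b b = 0\<close>, so that \<open>[b, a] = b\<close>. To compare
  coefficients instead of values, scalars are extended to the polynomial ring \<open>R\<close> over the field in
  variables \<open>X\<^sub>0, X\<^sub>1, \<dots>\<close>; the resulting algebra on \<open>R \<times> R\<close> is again \<open>\<delta>\<close>-Novikov over the field
  (\<open>affine_delta_novikov\<close>).

  Substitute \<open>X\<^sub>i a + [i = l] b\<close> for the generator \<open>x\<^sub>i\<close>, for one fixed \<open>l\<close> at a time. The
  \<open>b\<close>-component of the value of a monomial \<open>m\<close> is then its \<open>l\<close>-th coordinate under the Magnus
  embedding \<open>x\<^sub>i \<mapsto> X\<^sub>i + e\<^sub>i\<close> of the free metabelian Lie algebra, where \<open>X\<^sub>i\<close> acts on the free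
  \<open>R\<close>-module with basis \<open>e\<^sub>0, e\<^sub>1, \<dots>\<close> by multiplication. An identity of all \<open>\<delta>\<close>-Novikov commutator
  algebras therefore has all its Magnus coordinates equal to zero
  (\<open>magnus_coords_vanish_if_delta_novikov_identity\<close>).

  It remains to see that the Magnus coordinates determine the value in an arbitrary metabelian Lie
  algebra. There a monomial of degree at least two is, up to a scalar, a left-normed commutator
  \<open>[x\<^sub>i, x\<^sub>j, x\<^sub>k, \<dots>]\<close> in which the order of the letters after the first two does not matter. The Jacobi
  identity writes it as a difference of two normal forms, those left-normed commutators whose second
  letter is the smallest of all (\<open>ad_mset_bracket_eq_normal_forms\<close>). The point of the argument is that
  the coefficients in this expansion are exactly the coefficients of the Magnus coordinates
  (\<open>eval_mono_eq_sum_normal_forms\<close>). Hence a polynomial with vanishing Magnus coordinates has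
  only zero coefficients in front of its normal forms.\<close>

section \<open>A \<open>\<delta>\<close>-Novikov algebra with a generic affine commutator\<close>

definition affine_scale :: "('f \<Rightarrow> 'r::comm_ring_1) \<Rightarrow> 'f \<Rightarrow> 'r \<times> 'r \<Rightarrow> 'r \<times> 'r" where
  "affine_scale \<phi> c x = (\<phi> c * fst x, \<phi> c * snd x)"

definition affine_mult :: "'r::comm_ring_1 \<Rightarrow> 'r \<times> 'r \<Rightarrow> 'r \<times> 'r \<Rightarrow> 'r \<times> 'r" where
  "affine_mult d x y = (d * fst x * fst y, snd x * fst y)"

text \<open>The map \<open>\<phi>\<close> is a ring homomorphism that makes \<open>R\<close> an algebra over the field. In
  \<open>(x y) z\<close> the factors \<open>y\<close> and \<open>z\<close> enter only through the product of their first components. In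
  \<open>\<delta> (x y) z - x (y z)\<close> the second component vanishes because \<open>a a = \<delta> a\<close>, and the first one is
  a multiple of the product of the three first components.\<close>

lemma affine_delta_novikov:
  fixes \<phi> :: "'f::field \<Rightarrow> 'r::comm_ring_1"
  assumes add: "\<And>a b. \<phi> (a + b) = \<phi> a + \<phi> b"
    and mult: "\<And>a b. \<phi> (a * b) = \<phi> a * \<phi> b" and one: "\<phi> 1 = 1"
  shows "delta_novikov_algebra (affine_scale \<phi>) UNIV (affine_mult (\<phi> \<delta>)) \<delta>"
proof -
  interpret V: vector_space "affine_scale \<phi>"
    by standard (auto simp: affine_scale_def add mult one algebra_simps)
  show ?thesis
    by standard (auto simp: affine_scale_def affine_mult_def algebra_simps)
qed

text \<open>The parameter \<open>d\<close> cancels, so that one Lie algebra serves all values of \<open>\<delta>\<close>.\<close>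

lemma commutator_affine_mult:
  "commutator (affine_mult d) x y = (0, snd x * fst y - fst x * snd y)"
  by (simp add: commutator_def affine_mult_def minus_prod_def mult.commute mult.left_commute)

text \<open>A multiset of indices is the exponent of a monomial in the \<open>X\<^sub>i\<close>, so
  \<open>nat multiset \<Rightarrow>\<^sub>0 'f\<close> is the polynomial ring \<open>R\<close>.\<close>

definition generic_point :: "nat \<Rightarrow> nat \<Rightarrow> (nat multiset \<Rightarrow>\<^sub>0 'f::comm_ring_1) \<times> (nat multiset \<Rightarrow>\<^sub>0 'f)" where
  "generic_point l i = (Poly_Mapping.single {#i#} 1, if i = l then 1 else 0)"

text \<open>The coefficient at \<open>e\<^sub>l\<close> of the image of \<open>m\<close> under the Magnus embedding: only the terms with
  \<open>b\<close> contributed by \<open>x\<^sub>l\<close> survive at \<open>generic_point l\<close>.\<close>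

definition magnus_coord :: "nat \<Rightarrow> na_mono \<Rightarrow> nat multiset \<Rightarrow>\<^sub>0 'f::comm_ring_1" where
  "magnus_coord l m = snd (eval_mono (\<lambda>x y. (0, snd x * fst y - fst x * snd y)) (generic_point l) m)"

lemma magnus_coord_Var: "magnus_coord l (Var i) = (if i = l then 1 else 0)"
  by (simp add: magnus_coord_def generic_point_def)

lemma magnus_coord_Prod_Var_Var:
  "magnus_coord l (Prod (Var i) (Var j)) =
    Poly_Mapping.single {#j#} (if i = l then 1 else 0) - Poly_Mapping.single {#i#} (if j = l then 1 else 0)"
  by (simp add: magnus_coord_def generic_point_def)

lemma magnus_coord_Prod_Prod_Var:
  "magnus_coord l (Prod (Prod s t) (Var k)) = magnus_coord l (Prod s t) * Poly_Mapping.single {#k#} 1"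
  by (simp add: magnus_coord_def generic_point_def)

lemma magnus_coord_Prod_Var_Prod:
  "magnus_coord l (Prod (Var k) (Prod s t)) = - (magnus_coord l (Prod s t) * Poly_Mapping.single {#k#} 1)"
  by (simp add: magnus_coord_def generic_point_def mult.commute)

lemma magnus_coord_Prod_Prod_Prod: "magnus_coord l (Prod (Prod s t) (Prod u v)) = 0"
  by (simp add: magnus_coord_def)

section \<open>Normal forms in a metabelian Lie algebra\<close>

context metabelian_lie_algebra
begin

lemma bracket_0_left [simp]: "y \<in> A \<Longrightarrow> bracket 0 y = 0"
  using mult_scale_left[of y y 0] by simp

lemma bracket_minus_left: "\<lbrakk>y \<in> A; z \<in> A\<rbrakk> \<Longrightarrow> bracket (- y) z = - bracket y z"
  using mult_scale_left[of y z "-1"] by simp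

lemma bracket_self [simp]:
  assumes "y \<in> A" shows "bracket y y = 0"
proof -
  have "scale 2 (bracket y y) = bracket y y + bracket y y"
    using scale_left_distrib[of 1 1 "bracket y y"] by simp
  also have "\<dots> = 0"
    using anticommutative[OF assms assms] by (metis add.right_inverse)
  finally show ?thesis by simp
qed

text \<open>On this ideal, which contains the derived algebra, the adjoint maps commute with each other, so that
  products of them can be indexed by multisets.\<close>

definition derived_centralizer :: "'a set" where
  "derived_centralizer = {y \<in> A. \<forall>u\<in>A. \<forall>v\<in>A. bracket y (bracket u v) = 0}"

lemma derived_centralizer_in_carrier: "y \<in> derived_centralizer \<Longrightarrow> y \<in> A"
  by (simp add: derived_centralizer_def)

lemma bracket_in_derived_centralizer: "\<lbrakk>y \<in> A; z \<in> A\<rbrakk> \<Longrightarrow> bracket y z \<in> derived_centralizer"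
  by (simp add: derived_centralizer_def mult_closed metabelian)

lemma subspace_derived_centralizer: "subspace derived_centralizer"
  using subspace_A
  by (auto simp: subspace_def derived_centralizer_def mult_closed mult_add_left mult_scale_left)

lemma bracket_swap_on_derived_centralizer:
  assumes "y \<in> derived_centralizer" "u \<in> A" "v \<in> A"
  shows "bracket (bracket y u) v = bracket (bracket y v) u"
proof -
  have y: "y \<in> A" and 0: "bracket y (bracket u v) = 0"
    using assms by (auto simp: derived_centralizer_def)
  have "bracket (bracket u v) y = 0"
    using 0 anticommutative[of "bracket u v" y] y assms by (simp add: mult_closed)
  moreover have "bracket (bracket v y) u = - bracket (bracket y v) u"
    using anticommutative[of v y] y assms by (simp add: bracket_minus_left mult_closed)
  ultimately show ?thesis
    using jacobi[of y u v] y assms by (simp add: algebra_simps)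
qed

end

locale metabelian_lie_substitution = metabelian_lie_algebra scale A bracket
  for scale :: "'f::field_char_0 \<Rightarrow> 'a::ab_group_add \<Rightarrow> 'a" and A bracket +
  fixes x :: "nat \<Rightarrow> 'a"
  assumes x_in [simp]: "x i \<in> A"
begin

text \<open>Set to zero off \<open>derived_centralizer\<close>, the map commutes with its siblings everywhere, as
  \<open>fold_mset\<close> demands.\<close>

definition ad_var :: "nat \<Rightarrow> 'a \<Rightarrow> 'a" where
  "ad_var k y = (if y \<in> derived_centralizer then bracket y (x k) else 0)"

definition ad_mset :: "nat multiset \<Rightarrow> 'a \<Rightarrow> 'a" where
  "ad_mset K y = fold_mset ad_var y K"

lemma zero_in_derived_centralizer: "0 \<in> derived_centralizer"
  using subspace_0[OF subspace_derived_centralizer] .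

lemma ad_var_in: "ad_var k y \<in> derived_centralizer"
  by (simp add: ad_var_def bracket_in_derived_centralizer derived_centralizer_in_carrier
      zero_in_derived_centralizer)

lemma ad_var_add:
  "\<lbrakk>y \<in> derived_centralizer; z \<in> derived_centralizer\<rbrakk> \<Longrightarrow> ad_var k (y + z) = ad_var k y + ad_var k z"
  using subspace_add[OF subspace_derived_centralizer]
  by (simp add: ad_var_def mult_add_left derived_centralizer_in_carrier)

lemma ad_var_commute: "ad_var j (ad_var k y) = ad_var k (ad_var j y)"
  by (simp add: ad_var_def zero_in_derived_centralizer bracket_in_derived_centralizer
      derived_centralizer_in_carrier bracket_swap_on_derived_centralizer[of y "x k" "x j"])

sublocale ad_var: comp_fun_commute ad_var
  by standard (simp add: fun_eq_iff ad_var_commute)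

lemma ad_mset_empty [simp]: "ad_mset {#} y = y"
  by (simp add: ad_mset_def)

lemma ad_mset_add_outer: "ad_mset (add_mset k K) y = ad_var k (ad_mset K y)"
  by (simp add: ad_mset_def)

lemma ad_mset_add_inner: "ad_mset (add_mset k K) y = ad_mset K (ad_var k y)"
  by (simp add: ad_mset_def ad_var.fold_mset_fun_left_comm)

lemma ad_mset_in: "y \<in> derived_centralizer \<Longrightarrow> ad_mset K y \<in> derived_centralizer"
  by (cases K) (simp_all add: ad_mset_add_outer ad_var_in)

lemma ad_mset_add:
  "\<lbrakk>y \<in> derived_centralizer; z \<in> derived_centralizer\<rbrakk> \<Longrightarrow> ad_mset K (y + z) = ad_mset K y + ad_mset K z"
  by (induction K) (simp_all add: ad_mset_add_outer ad_var_add ad_mset_in)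

lemma ad_mset_0: "ad_mset K 0 = 0"
  using ad_mset_add[OF zero_in_derived_centralizer zero_in_derived_centralizer, of K] by simp

lemma ad_mset_minus: "y \<in> derived_centralizer \<Longrightarrow> ad_mset K (- y) = - ad_mset K y"
  using ad_mset_add[of y "- y" K] subspace_neg[OF subspace_derived_centralizer, of y]
  by (simp add: ad_mset_0 eq_neg_iff_add_eq_0 add.commute)

lemma ad_mset_diff:
  "\<lbrakk>y \<in> derived_centralizer; z \<in> derived_centralizer\<rbrakk> \<Longrightarrow> ad_mset K (y - z) = ad_mset K y - ad_mset K z"
  using ad_mset_add[of y "- z" K] subspace_neg[OF subspace_derived_centralizer, of z]
  by (simp add: ad_mset_minus)

text \<open>\<open>normal_form i E\<close> is the counterpart of the Magnus term \<open>X\<^sup>E e\<^sub>i\<close>: a commutator in the letters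
  \<open>x\<^sub>i\<close> and \<open>E\<close>, with \<open>x\<^sub>i\<close> in the first place and the smallest letter \<open>x\<^sub>k\<close> in the second.
  If \<open>k = i\<close> and \<open>E\<close> is not empty, the inner bracket is zero and so is the value, whether or not
  \<open>k\<close> occurs in \<open>E\<close>.\<close>

definition normal_form :: "nat \<Rightarrow> nat multiset \<Rightarrow> 'a" where
  "normal_form i E =
    (if E = {#} then x i
     else let k = Min_mset (add_mset i E) in ad_mset (E - {#k#}) (bracket (x i) (x k)))"

text \<open>Let \<open>k\<close> be the smallest letter. If \<open>k\<close> is \<open>i\<close> or \<open>j\<close>, one of the two normal forms is zero and the
  other one is the left-hand side up to sign. Otherwise \<open>k\<close> is a letter of \<open>K\<close>; it can be moved next to
  \<open>[x\<^sub>i, x\<^sub>j]\<close>, and the Jacobi identity \<open>[[x\<^sub>i, x\<^sub>j], x\<^sub>k] = [[x\<^sub>i, x\<^sub>k], x\<^sub>j] - [[x\<^sub>j, x\<^sub>k], x\<^sub>i]\<close>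
  brings it to the second place.\<close>

lemma ad_mset_bracket_eq_normal_forms:
  "ad_mset K (bracket (x i) (x j)) = normal_form i (add_mset j K) - normal_form j (add_mset i K)"
proof -
  let ?D = "add_mset i (add_mset j K)"
  define k where "k = Min_mset ?D"
  have k: "k \<in># ?D" unfolding k_def by (rule Min_in) auto
  have Zb: "bracket (x a) (x b) \<in> derived_centralizer" for a b
    by (simp add: bracket_in_derived_centralizer)
  have nf_i: "normal_form i (add_mset j K) = ad_mset (add_mset j K - {#k#}) (bracket (x i) (x k))"
    by (simp add: normal_form_def Let_def k_def)
  have nf_j: "normal_form j (add_mset i K) = ad_mset (add_mset i K - {#k#}) (bracket (x j) (x k))"
    by (simp add: normal_form_def Let_def k_def insert_commute)
  consider "k = i" | "k = j" | "k \<noteq> i" "k \<noteq> j" "k \<in># K" using k by auto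
  then show ?thesis
  proof cases
    case 1
    then show ?thesis
      using anticommutative[of "x i" "x j"] by (simp add: nf_i nf_j ad_mset_0 ad_mset_minus Zb)
  next
    case 2
    then show ?thesis by (simp add: nf_i nf_j ad_mset_0)
  next
    case 3
    then obtain K' where K: "K = add_mset k K'" by (auto dest: multi_member_split)
    have "bracket (bracket (x i) (x j)) (x k) =
        bracket (bracket (x i) (x k)) (x j) - bracket (bracket (x j) (x k)) (x i)"
      using jacobi[of "x i" "x j" "x k"] anticommutative[of "x k" "x i"]
      by (simp add: bracket_minus_left mult_closed algebra_simps)
    then have "ad_mset K (bracket (x i) (x j)) =
        ad_mset (add_mset j K') (bracket (x i) (x k)) - ad_mset (add_mset i K') (bracket (x j) (x k))"
      by (simp add: K ad_mset_add_inner ad_var_def Zb ad_mset_diff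
          bracket_in_derived_centralizer mult_closed)
    then show ?thesis
      using 3 unfolding nf_i nf_j by (simp add: K)
  qed
qed

text \<open>Evaluation in the given algebra and under the Magnus embedding are treated in one induction, because
  the same \<open>c\<close>, \<open>i\<close>, \<open>j\<close>, \<open>K\<close> must serve both: the Magnus image of \<open>[x\<^sub>i, x\<^sub>j]\<close>, acted upon by the
  letters of \<open>K\<close>, is \<open>X\<^sup>K (X\<^sub>j e\<^sub>i - X\<^sub>i e\<^sub>j)\<close>. The scalar \<open>c\<close> is \<open>1\<close> or \<open>-1\<close>, or it is \<open>0\<close> when
  two proper commutators are multiplied somewhere in the monomial.\<close>

lemma eval_Prod_proportional:
  "\<exists>c i j K. eval_mono bracket x (Prod s t) = scale c (ad_mset K (bracket (x i) (x j))) \<and>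
     (\<forall>l. magnus_coord l (Prod s t) =
        Poly_Mapping.single (add_mset j K) (if i = l then c else 0) -
        Poly_Mapping.single (add_mset i K) (if j = l then c else 0))"
    (is "\<exists>c i j K. ?P (Prod s t) c i j K")
proof (induction "Prod s t" arbitrary: s t)
  case (Prod s t)
  have append_var: "?P (Prod (Prod u v) (Var k)) c i j (add_mset k K)"
      "?P (Prod (Var k) (Prod u v)) (- c) i j (add_mset k K)" if "?P (Prod u v) c i j K" for u v k c i j K
  proof -
    let ?w = "eval_mono bracket x (Prod u v)"
    have Z: "ad_mset K (bracket (x i) (x j)) \<in> derived_centralizer"
      by (simp add: ad_mset_in bracket_in_derived_centralizer)
    then have A: "ad_mset K (bracket (x i) (x j)) \<in> A"
      by (rule derived_centralizer_in_carrier)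
    then have w: "?w \<in> A" using that subspace_scale[OF subspace_A] by simp
    have e: "bracket ?w (x k) = scale c (ad_mset (add_mset k K) (bracket (x i) (x j)))"
      using that A Z by (simp add: mult_scale_left ad_mset_add_outer ad_var_def)
    then show "?P (Prod (Prod u v) (Var k)) c i j (add_mset k K)"
      using that by (simp add: magnus_coord_Prod_Prod_Var left_diff_distrib mult_single add_mset_commute)
    have "bracket (x k) ?w = - bracket ?w (x k)"
      using w by (intro anticommutative x_in)
    with e show "?P (Prod (Var k) (Prod u v)) (- c) i j (add_mset k K)"
      using that by (simp add: magnus_coord_Prod_Var_Prod left_diff_distrib mult_single add_mset_commute
          single_uminus)
  qed
  show ?case
  proof (cases s; cases t)
    fix i j assume "s = Var i" "t = Var j"
    then have "?P (Prod s t) 1 i j {#}" by (simp add: magnus_coord_Prod_Var_Var)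
    then show ?thesis by (intro exI)
  next
    fix u v k assume st: "s = Prod u v" "t = Var k"
    from Prod(1)[OF st(1)] obtain c i j K where "?P (Prod u v) c i j K"
      by (elim exE) (rule that)
    then have "?P (Prod s t) c i j (add_mset k K)"
      unfolding st by (rule append_var(1))
    then show ?thesis by (intro exI)
  next
    fix u v k assume st: "s = Var k" "t = Prod u v"
    from Prod(2)[OF st(2)] obtain c i j K where "?P (Prod u v) c i j K"
      by (elim exE) (rule that)
    then have "?P (Prod s t) (- c) i j (add_mset k K)"
      unfolding st by (rule append_var(2))
    then show ?thesis by (intro exI)
  next
    fix u v u' v' assume st: "s = Prod u v" "t = Prod u' v'"
    have "eval_mono bracket x m \<in> A" for m
      by (induction m) (simp_all add: mult_closed)
    then have "?P (Prod s t) 0 0 0 {#}"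
      by (simp add: st magnus_coord_Prod_Prod_Prod metabelian)
    then show ?thesis by (intro exI)
  qed
qed

text \<open>A lower bound \<open>S\<close> on the index set, in place of a specific one, lets several monomials be
  expanded over a common index set.\<close>

lemma eval_mono_eq_sum_normal_forms:
  "\<exists>S. finite S \<and> (\<forall>P. finite P \<longrightarrow> S \<subseteq> P \<longrightarrow>
     eval_mono bracket x m =
       (\<Sum>(l, E)\<in>P. scale (Poly_Mapping.lookup (magnus_coord l m) E) (normal_form l E)))"
proof -
  have "\<exists>p q c d.
      eval_mono bracket x m = scale c (case_prod normal_form p) - scale d (case_prod normal_form q) \<and>
      (\<forall>l E. Poly_Mapping.lookup (magnus_coord l m) E =
         (if (l, E) = p then c else 0) - (if (l, E) = q then d else 0))"
    (is "\<exists>p q c d. ?Q p q c d")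
  proof (cases m)
    case (Var i)
    \<comment> \<open>A generator is a single normal form; the second term is a dummy with coefficient zero.\<close>
    have "?Q (i, {#}) (i, {#}) 1 0"
      by (simp add: Var magnus_coord_Var normal_form_def lookup_one when_def)
    then show ?thesis by (intro exI)
  next
    case (Prod s t)
    from eval_Prod_proportional[of s t, folded Prod] obtain c i j K where P:
      "eval_mono bracket x m = scale c (ad_mset K (bracket (x i) (x j))) \<and>
       (\<forall>l. magnus_coord l m = Poly_Mapping.single (add_mset j K) (if i = l then c else 0) -
         Poly_Mapping.single (add_mset i K) (if j = l then c else 0))"
      by (elim exE) (rule that)
    have "?Q (i, add_mset j K) (j, add_mset i K) c c"
      using P by (simp add: ad_mset_bracket_eq_normal_forms scale_right_diff_distrib lookup_minus
          lookup_single when_def)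
    then show ?thesis by (intro exI)
  qed
  then obtain p q c d where "?Q p q c d"
    by (elim exE) (rule that)
  then have
    e: "eval_mono bracket x m = scale c (case_prod normal_form p) - scale d (case_prod normal_form q)"
    and w: "\<And>l E. Poly_Mapping.lookup (magnus_coord l m) E =
        (if (l, E) = p then c else 0) - (if (l, E) = q then d else 0)"
    by simp_all
  have "eval_mono bracket x m =
      (\<Sum>(l, E)\<in>P. scale (Poly_Mapping.lookup (magnus_coord l m) E) (normal_form l E))"
    if "finite P" "{p, q} \<subseteq> P" for P
  proof -
    have "(\<Sum>(l, E)\<in>P. scale (Poly_Mapping.lookup (magnus_coord l m) E) (normal_form l E)) =
      (\<Sum>r\<in>P. (if r = p then scale c (case_prod normal_form p) else 0) -
               (if r = q then scale d (case_prod normal_form q) else 0))"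
      by (intro sum.cong) (auto simp: w scale_left_diff_distrib)
    then show ?thesis
      using that by (simp add: sum_subtractf e)
  qed
  then show ?thesis by (intro exI[of _ "{p, q}"]) auto
qed

lemma eval_poly_zero_if_magnus_coords_vanish:
  fixes f :: "'f na_poly"
  assumes "\<And>l E. (\<Sum>m\<in>Poly_Mapping.keys f.
      Poly_Mapping.lookup f m * Poly_Mapping.lookup (magnus_coord l m) E) = 0"
  shows "eval_poly scale bracket x f = 0"
proof -
  let ?c = "\<lambda>m p. Poly_Mapping.lookup (magnus_coord (fst p) m) (snd p) :: 'f"
    and ?nf = "\<lambda>p. normal_form (fst p) (snd p)"
  have "\<exists>S. \<forall>m. finite (S m) \<and>
      (\<forall>P. finite P \<longrightarrow> S m \<subseteq> P \<longrightarrow> eval_mono bracket x m = (\<Sum>p\<in>P. scale (?c m p) (?nf p)))"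
    using eval_mono_eq_sum_normal_forms unfolding case_prod_beta by (intro choice allI)
  then obtain S where "\<forall>m. finite (S m) \<and>
      (\<forall>P. finite P \<longrightarrow> S m \<subseteq> P \<longrightarrow> eval_mono bracket x m = (\<Sum>p\<in>P. scale (?c m p) (?nf p)))" ..
  then have S: "finite (S m)"
    and e: "finite P \<Longrightarrow> S m \<subseteq> P \<Longrightarrow> eval_mono bracket x m = (\<Sum>p\<in>P. scale (?c m p) (?nf p))" for m P
    by simp_all
  define P where "P = (\<Union>m\<in>Poly_Mapping.keys f. S m)"
  have "eval_poly scale bracket x f =
      (\<Sum>m\<in>Poly_Mapping.keys f. \<Sum>p\<in>P. scale (Poly_Mapping.lookup f m * ?c m p) (?nf p))"
    unfolding eval_poly_def
  proof (rule sum.cong[OF refl])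
    fix m assume "m \<in> Poly_Mapping.keys f"
    then have "eval_mono bracket x m = (\<Sum>p\<in>P. scale (?c m p) (?nf p))"
      by (intro e) (auto simp: P_def S)
    then show "scale (Poly_Mapping.lookup f m) (eval_mono bracket x m) =
        (\<Sum>p\<in>P. scale (Poly_Mapping.lookup f m * ?c m p) (?nf p))"
      by (simp add: scale_sum_right)
  qed
  also have "\<dots> = (\<Sum>p\<in>P. scale (\<Sum>m\<in>Poly_Mapping.keys f. Poly_Mapping.lookup f m * ?c m p) (?nf p))"
    by (subst sum.swap) (simp add: scale_sum_left)
  finally show ?thesis by (simp add: assms)
qed

end

section \<open>Identities of the generic affine algebra\<close>

lemma lookup_single_0_times:
  "Poly_Mapping.lookup (Poly_Mapping.single 0 c * p) E = c * Poly_Mapping.lookup p E"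
  for p :: "'m::comm_monoid_add \<Rightarrow>\<^sub>0 'f::comm_ring_1"
  by (simp add: Poly_Mapping.map.rep_eq when_def flip: mult_map_scale_conv_mult)

lemma magnus_coords_vanish_if_delta_novikov_identity:
  fixes \<delta> :: "'f::field" and f :: "'f na_poly"
  assumes "\<And>(scale :: 'f \<Rightarrow> 'f na_poly \<Rightarrow> 'f na_poly) N mult.
      delta_novikov_algebra scale N mult \<delta> \<Longrightarrow> is_identity scale N (commutator mult) f"
  shows "(\<Sum>m\<in>Poly_Mapping.keys f. Poly_Mapping.lookup f m * Poly_Mapping.lookup (magnus_coord l m) E) = 0"
proof -
  let ?\<phi> = "Poly_Mapping.single 0 :: 'f \<Rightarrow> nat multiset \<Rightarrow>\<^sub>0 'f"
  let ?mult = "commutator (affine_mult (?\<phi> \<delta>))"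
  have "delta_novikov_algebra (affine_scale ?\<phi>) UNIV (affine_mult (?\<phi> \<delta>)) \<delta>"
    by (intro affine_delta_novikov) (simp_all add: single_add mult_single)
  then have "is_identity (affine_scale ?\<phi>) UNIV ?mult f"
    by (rule is_identity_delta_novikov_any_type[rotated]) (rule assms)
  then have "0 = eval_poly (affine_scale ?\<phi>) ?mult (generic_point l) f"
    by (simp add: is_identity_def)
  then have "0 = Poly_Mapping.lookup (snd (eval_poly (affine_scale ?\<phi>) ?mult (generic_point l) f)) E"
    by (metis lookup_zero snd_zero)
  also have "snd (eval_poly (affine_scale ?\<phi>) ?mult (generic_point l) f) =
      (\<Sum>m\<in>Poly_Mapping.keys f. ?\<phi> (Poly_Mapping.lookup f m) * magnus_coord l m)"
    by (simp add: eval_poly_def snd_sum affine_scale_def magnus_coord_def commutator_affine_mult[abs_def])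
  finally show ?thesis
    by (simp add: lookup_sum lookup_single_0_times)
qed

theorem theorem32:
  fixes \<delta> :: "'f::field_char_0"
    and f :: "'f na_poly"
    and scaleL :: "'f \<Rightarrow> 'a::ab_group_add \<Rightarrow> 'a"
    and L :: "'a set"
    and bracket :: "'a \<Rightarrow> 'a \<Rightarrow> 'a"
  assumes "\<delta> \<noteq> 1"
    and "\<And>(scale :: 'f \<Rightarrow> 'f na_poly \<Rightarrow> 'f na_poly) N mult.
           delta_novikov_algebra scale N mult \<delta> \<Longrightarrow> is_identity scale N (commutator mult) f"
    and "metabelian_lie_algebra scaleL L bracket"
  shows "is_identity scaleL L bracket f"
  unfolding is_identity_def
proof (intro allI impI)
  fix \<rho> :: "nat \<Rightarrow> 'a"
  assume "\<forall>i. \<rho> i \<in> L"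
  then interpret metabelian_lie_substitution scaleL L bracket \<rho>
    using assms(3) by (simp add: metabelian_lie_substitution_def metabelian_lie_substitution_axioms_def)
  show "eval_poly scaleL bracket \<rho> f = 0"
    by (intro eval_poly_zero_if_magnus_coords_vanish magnus_coords_vanish_if_delta_novikov_identity assms(2))
qed

end
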